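(* Let $X,Y$ be complete metric spaces and $E,F$ nontrivial Banach spaces. Let either $A(X,E)=U(X,E)$ and $A(Y,F)=U(Y,F)$, or $A(X,E)=U_*(X,E)$ and $A(Y,F)=U_*(Y,F)$. Suppose that $T$ is a biseparating map from $A(X,E)$ onto $A(Y,F)$, represented as $Tf(y)=\Phi(y,f(\varphi^{-1}(y)))$ for all $f\in A(X,E)$, $y\in Y$, where $\varphi:X\to Y$ is a uniform homeomorphism and $\Phi:Y\times E\to F$ is such that $\Phi(y,\cdot):E\to F$ is a bijection for each $y\in Y$. Assume that $f\in A(X,E)$ and $S\subseteq X'$. For any $\varepsilon>0$, there exists $\delta>0$ such that if $g\in A(X,E)$ and $\|g-f\|_S<\delta$, then $\|Tg-Tf\|_{\varphi(S)}<\varepsilon$.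
   Context: $U(X,E)$ is the space of uniformly continuous functions $X\to E$ and $U_*(X,E)$ its subspace of bounded functions. $X'$ is the set of accumulation points of $X$. For a set $S$ and a function $f$ defined on a set containing $S$, $\|f\|_S=\sup_{s\in S}\|f(s)\|$. A uniform homeomorphism is a bijection that is uniformly continuous with uniformly continuous inverse. For a function $f$ let $C(f)=\{x: f(x)\neq 0\}$, and write $f\perp_h g$ if $C(f-h)\cap C(g-h)=\emptyset$. A map $T$ (not assumed linear) between two function spaces is biseparating if it is a bijection and for all $f,g,h$ in its domain: $f\perp_h g\iff Tf\perp_{Th}Tg$. The paper proves that every such biseparating map has a representation of the stated form. *)

theory Defs
  imports "HOL-Analysis.Analysis"
begin

definition U_space :: "('a::metric_space \<Rightarrow> 'b::real_normed_vector) set" where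
  "U_space = {f. uniformly_continuous_on UNIV f}"

definition Ub_space :: "('a::metric_space \<Rightarrow> 'b::real_normed_vector) set" where
  "Ub_space = {f \<in> U_space. bounded (range f)}"

definition accumulation_points :: "'a::topological_space set" where
  "accumulation_points = {x. x islimpt UNIV}"

text \<open>The supremum is taken in \<^typ>\<open>ennreal\<close>: it is infinite when the function is unbounded on the
  set (which happens for differences of elements of \<^const>\<open>U_space\<close>), and \<open>0\<close> on the empty set.\<close>

definition sup_norm_on :: "'a set \<Rightarrow> ('a \<Rightarrow> 'b::real_normed_vector) \<Rightarrow> ennreal" where
  "sup_norm_on S f = (SUP s\<in>S. ennreal (norm (f s)))"

definition uniform_homeomorphism :: "('a::metric_space \<Rightarrow> 'b::metric_space) \<Rightarrow> bool" where
  "uniform_homeomorphism \<phi> \<longleftrightarrow>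
     bij \<phi> \<and> uniformly_continuous_on UNIV \<phi> \<and> uniformly_continuous_on UNIV (inv \<phi>)"

definition carrier_set :: "('a \<Rightarrow> 'b::zero) \<Rightarrow> 'a set" where
  "carrier_set f = {x. f x \<noteq> 0}"

definition perp_rel :: "('a \<Rightarrow> 'b::ab_group_add) \<Rightarrow> ('a \<Rightarrow> 'b) \<Rightarrow> ('a \<Rightarrow> 'b) \<Rightarrow> bool" where
  "perp_rel h f g \<longleftrightarrow>
     carrier_set (\<lambda>x. f x - h x) \<inter> carrier_set (\<lambda>x. g x - h x) = {}"

text \<open>Only the values of \<open>T\<close> on \<open>A\<close> matter.\<close>

definition biseparating ::
  "('x \<Rightarrow> 'e::ab_group_add) set \<Rightarrow> ('y \<Rightarrow> 'f::ab_group_add) set \<Rightarrow>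
   (('x \<Rightarrow> 'e) \<Rightarrow> ('y \<Rightarrow> 'f)) \<Rightarrow> bool" where
  "biseparating A B T \<longleftrightarrow>
     bij_betw T A B \<and>
     (\<forall>f\<in>A. \<forall>g\<in>A. \<forall>h\<in>A. perp_rel h f g \<longleftrightarrow> perp_rel (T h) (T f) (T g))"

end

theory Submission
  imports Defs
begin

text \<open>Suppose that no \<open>\<delta>\<close> works. Then there are functions \<open>G n\<close> in \<open>A\<close> and points \<open>s n\<close> in \<open>S\<close> such that
  \<open>G n\<close> and \<open>f\<close> almost agree at \<open>s n\<close>, while their images under \<open>T\<close> stay more than \<open>\<epsilon> / 2\<close> apart at
  \<open>\<phi> (s n)\<close>. By continuity the same holds on an open neighbourhood \<open>W n\<close> of \<open>s n\<close>. The contradiction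
  comes from a single function \<open>g\<close> in \<open>A\<close> which agrees with some \<open>G n\<close> at a point \<open>x k\<close> of \<open>W n\<close>, for
  infinitely many \<open>n\<close>, but agrees with \<open>f\<close> at points \<open>t k\<close> whose distance to \<open>x k\<close> tends to \<open>0\<close>.
  Since the value of \<open>T u\<close> at \<open>\<phi> z\<close> depends only on \<open>u z\<close>, the function \<open>D z = T g (\<phi> z) - T f (\<phi> z)\<close>
  vanishes at every \<open>t k\<close> and has norm more than \<open>\<epsilon> / 2\<close> at every \<open>x k\<close>, although it is uniformly
  continuous.

  Two constructions make this work. \<open>vanishing_bumps_on_disjoint_balls\<close> provides \<open>g - f\<close>: bumps on
  disjoint balls around the \<open>x k\<close>, whose heights tend to \<open>0\<close>. However small the balls are, the sum is
  uniformly continuous, because only finitely many bumps are higher than a given positive number and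
  each of them is Lipschitz. So the only demand on the points is that the balls be disjoint and miss all the
  \<open>t k\<close>. \<open>disjoint_balls_near_accumulation_points\<close> finds such points. If the \<open>s n\<close> have a cluster point
  \<open>p\<close>, then the \<open>x k\<close> are chosen to converge to \<open>p\<close> and all \<open>t k\<close> are \<open>p\<close>; accumulation is
  needed to choose \<open>x k\<close> different from \<open>p\<close>, for example when all the \<open>s n\<close> coincide. Otherwise
  the \<open>x k\<close> form a subsequence of \<open>s\<close>, and accumulation provides the nearby points \<open>t k\<close>.\<close>

section \<open>Vector-valued bumps on disjoint balls\<close>

lemma uniformly_continuous_on_uniform_limit:
  fixes g :: "'i \<Rightarrow> 'a::metric_space \<Rightarrow> 'b::metric_space"
  assumes lim: "uniform_limit X g h F" and F: "F \<noteq> bot"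
    and g: "\<And>i. uniformly_continuous_on X (g i)"
  shows "uniformly_continuous_on X h"
  unfolding uniformly_continuous_on_def
proof (intro allI impI)
  fix e :: real assume "e > 0"
  then have e3: "e / 3 > 0" by simp
  then have "\<forall>\<^sub>F i in F. \<forall>z\<in>X. dist (g i z) (h z) < e / 3"
    by (rule uniform_limitD[OF lim])
  then obtain i where i: "\<And>z. z \<in> X \<Longrightarrow> dist (g i z) (h z) < e / 3"
    using eventually_happens'[OF F] by blast
  obtain d where "d > 0" and d: "\<And>u v. u \<in> X \<Longrightarrow> v \<in> X \<Longrightarrow> dist v u < d \<Longrightarrow>
      dist (g i v) (g i u) < e / 3"
    using uniformly_continuous_onE[OF g[of i] e3] by blast
  have "dist (h v) (h u) < e" if "u \<in> X" "v \<in> X" "dist v u < d" for u v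
    using i[OF that(1)] i[OF that(2)] d[OF that] dist_triangle[of "h v" "h u" "g i v"]
      dist_triangle[of "g i v" "h u" "g i u"] dist_commute[of "h v" "g i v"] by linarith
  then show "\<exists>d>0. \<forall>u\<in>X. \<forall>v\<in>X. dist v u < d \<longrightarrow> dist (h v) (h u) < e"
    using \<open>d > 0\<close> by blast
qed

text \<open>A sum of tent functions with the prescribed vectors as heights. At each point at most one tent
  is nonzero, so the sum differs from its \<open>n\<close>-th partial sum by at most the supremum of the later
  heights. Hence it is a uniform limit of finite sums of Lipschitz functions.\<close>

lemma vanishing_bumps_on_disjoint_balls:
  fixes x :: "nat \<Rightarrow> 'a::metric_space" and b :: "nat \<Rightarrow> 'b::real_normed_vector"
  assumes r: "\<And>k. r k > 0"
    and disj: "disjoint_family (\<lambda>k. ball (x k) (r k))"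
    and b: "b \<longlonglongrightarrow> 0"
  obtains h where "h \<in> Ub_space" and "\<And>k. h (x k) = b k"
    and "\<And>z. \<forall>k. z \<notin> ball (x k) (r k) \<Longrightarrow> h z = 0"
proof -
  define \<beta> where "\<beta> k z = max 0 (1 - dist z (x k) / r k) *\<^sub>R b k" for k z
  define h where "h z = (\<Sum>k. \<beta> k z)" for z
  have \<beta>_zero: "\<beta> k z = 0" if "z \<notin> ball (x k) (r k)" for k z
    using that r[of k] by (simp add: \<beta>_def dist_commute field_simps max_def)
  have \<beta>_le: "norm (\<beta> k z) \<le> norm (b k)" for k z
  proof -
    have "\<bar>max 0 (1 - dist z (x k) / r k)\<bar> \<le> 1"
      using r[of k] by simp
    then show ?thesis
      unfolding \<beta>_def norm_scaleR by (rule mult_left_le_one_le[OF norm_ge_zero abs_ge_zero])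
  qed
  have single: "\<exists>k. \<forall>j. j \<noteq> k \<longrightarrow> \<beta> j z = 0" for z
  proof (cases "\<exists>k. z \<in> ball (x k) (r k)")
    case True
    then obtain k where "z \<in> ball (x k) (r k)" by blast
    then have "z \<notin> ball (x j) (r j)" if "j \<noteq> k" for j
      using disjoint_family_onD[OF disj, of k j] that by blast
    then show ?thesis using \<beta>_zero by blast
  qed (use \<beta>_zero in blast)
  have h_eq: "h z = \<beta> k z" if "\<forall>j. j \<noteq> k \<longrightarrow> \<beta> j z = 0" for k z
    unfolding h_def using that suminf_finite[of "{k}" "\<lambda>k. \<beta> k z"] by simp
  have tail: "\<forall>z. norm (h z - (\<Sum>j<n. \<beta> j z)) \<le> e"
    if "\<And>k. k \<ge> n \<Longrightarrow> norm (b k) \<le> e" and "e \<ge> 0" for n e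
  proof
    fix z
    obtain k where k: "\<forall>j. j \<noteq> k \<longrightarrow> \<beta> j z = 0" using single by blast
    have "(\<Sum>j<n. \<beta> j z) = (\<Sum>j<n. if j = k then \<beta> k z else 0)"
      by (rule sum.cong) (use k in auto)
    then have "(\<Sum>j<n. \<beta> j z) = (if k < n then \<beta> k z else 0)"
      by simp
    then show "norm (h z - (\<Sum>j<n. \<beta> j z)) \<le> e"
      using h_eq[OF k] that \<beta>_le[of k z] order_trans by (auto simp: not_less)
  qed
  have \<beta>_uc: "uniformly_continuous_on UNIV (\<beta> k)" for k
  proof -
    have "(norm (b k) / r k)-lipschitz_on UNIV (\<beta> k)"
    proof (rule lipschitz_onI)
      fix u v :: 'a
      have "\<bar>max 0 (1 - dist u (x k) / r k) - max 0 (1 - dist v (x k) / r k)\<bar>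
          \<le> \<bar>dist u (x k) / r k - dist v (x k) / r k\<bar>"
        by linarith
      also have "\<dots> = \<bar>dist u (x k) - dist v (x k)\<bar> / r k"
        using r[of k] by (simp add: diff_divide_distrib[symmetric])
      also have "\<dots> \<le> dist u v / r k"
        using r[of k] abs_dist_diff_le[of u "x k" v] by (simp add: divide_right_mono dist_commute[of v])
      finally have "\<bar>max 0 (1 - dist u (x k) / r k) - max 0 (1 - dist v (x k) / r k)\<bar> * norm (b k)
          \<le> dist u v / r k * norm (b k)"
        by (rule mult_right_mono) simp
      then show "dist (\<beta> k u) (\<beta> k v) \<le> norm (b k) / r k * dist u v"
        by (simp add: \<beta>_def dist_norm mult.commute flip: scaleR_diff_left)
    qed (use r[of k] in simp)
    then show ?thesis by (rule lipschitz_on_uniformly_continuous)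
  qed
  have partial_uc: "uniformly_continuous_on UNIV (\<lambda>z. \<Sum>j<n. \<beta> j z)" for n
    by (intro uniformly_continuous_on_sum \<beta>_uc)
  have "uniform_limit UNIV (\<lambda>n z. \<Sum>j<n. \<beta> j z) h sequentially"
  proof (rule uniform_limitI)
    fix e :: real assume "e > 0"
    then have "e / 2 > 0" by simp
    then obtain n0 where n0: "\<And>k. k \<ge> n0 \<Longrightarrow> norm (b k) < e / 2"
      using LIMSEQ_D[OF b, of "e / 2"] by auto
    have "\<forall>z\<in>UNIV. dist (\<Sum>j<n. \<beta> j z) (h z) < e" if "n \<ge> n0" for n
    proof
      fix z
      have "norm (h z - (\<Sum>j<n. \<beta> j z)) \<le> e / 2"
        by (rule tail[rule_format]) (use n0 that \<open>e > 0\<close> in \<open>auto intro!: less_imp_le\<close>)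
      then show "dist (\<Sum>j<n. \<beta> j z) (h z) < e"
        using \<open>e > 0\<close> by (simp add: dist_norm norm_minus_commute)
    qed
    then show "\<forall>\<^sub>F n in sequentially. \<forall>z\<in>UNIV. dist (\<Sum>j<n. \<beta> j z) (h z) < e"
      unfolding eventually_sequentially by blast
  qed
  then have "uniformly_continuous_on UNIV h"
    by (rule uniformly_continuous_on_uniform_limit) (auto simp: partial_uc)
  moreover have "bounded (range h)"
  proof -
    obtain C where C: "\<And>k. norm (b k) \<le> C"
      using convergent_imp_Bseq[OF convergentI[OF b]] by (auto simp: Bseq_def)
    have "C \<ge> 0" using C[of 0] norm_ge_zero order_trans by blast
    then have "\<forall>z. norm (h z) \<le> C" using tail[of 0 C] C by simp
    then show ?thesis by (auto simp: bounded_iff)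
  qed
  ultimately have "h \<in> Ub_space" by (simp add: Ub_space_def U_space_def)
  moreover have "h (x k) = b k" for k
  proof -
    have "\<beta> j (x k) = 0" if "j \<noteq> k" for j
    proof (rule \<beta>_zero)
      have "x k \<in> ball (x k) (r k)" using r by simp
      then show "x k \<notin> ball (x j) (r j)"
        using disjoint_family_onD[OF disj, of k j] that by blast
    qed
    then show ?thesis using h_eq[of k "x k"] by (simp add: \<beta>_def)
  qed
  moreover have "h z = 0" if "\<forall>k. z \<notin> ball (x k) (r k)" for z
    using that \<beta>_zero by (simp add: h_def)
  ultimately show thesis by (rule that)
qed

section \<open>Separating points chosen near accumulation points\<close>

text \<open>The distances from the chosen points to \<open>p\<close> decrease at least by the factor \<open>3\<close>. With half of
  these distances as radii, the balls are disjoint and none of them contains \<open>p\<close>.\<close>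

lemma disjoint_balls_near_cluster_point:
  fixes s :: "nat \<Rightarrow> 'a::metric_space"
  assumes acc: "\<And>n. s n islimpt UNIV"
    and W: "\<And>n. open (W n)" "\<And>n. s n \<in> W n"
    and p: "\<And>e. e > 0 \<Longrightarrow> infinite {n. dist (s n) p < e}"
  shows "\<exists>\<sigma> x r. strict_mono \<sigma> \<and> (\<forall>k::nat. x k \<in> W (\<sigma> k) \<and> r k > 0 \<and>
      dist (x k) p < 1 / (real k + 1) \<and> p \<notin> ball (x k) (r k)) \<and>
      disjoint_family (\<lambda>k. ball (x k) (r k))"
proof -
  have near: "\<exists>n y. n > m \<and> y \<in> W n \<and> y \<noteq> p \<and> dist y p < e" if e: "e > 0" for e and m :: nat
  proof -
    obtain n where n: "n > m" "dist (s n) p < e"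
      using p[OF e] by (auto simp: infinite_nat_iff_unbounded)
    have "s n \<in> W n \<inter> ball p e" "open (W n \<inter> ball p e)"
      using W n by (auto simp: dist_commute)
    with acc[of n] obtain y where y: "y \<in> W n \<inter> ball p e" "y \<noteq> s n"
      by (meson islimptE)
    show ?thesis
    proof (cases "s n = p")
      case True
      \<comment> \<open>The point \<open>s n\<close> itself is excluded here; its neighbour \<open>y\<close> in \<open>W n\<close> replaces it.\<close>
      with y have "y \<in> W n \<and> y \<noteq> p \<and> dist y p < e" by (simp add: dist_commute)
      with n show ?thesis by blast
    qed (use n W(2)[of n] in blast)
  qed
  define P where "P k c \<longleftrightarrow> snd c \<in> W (fst c) \<and> snd c \<noteq> p \<and> dist (snd c) p < 1 / (real k + 1)"
    for k :: nat and c :: "nat \<times> 'a"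
  have "\<exists>c. \<forall>k. P k (c k) \<and> (fst (c k) < fst (c (Suc k)) \<and>
      dist (snd (c (Suc k))) p < dist (snd (c k)) p / 3)"
  proof (rule dependent_nat_choice)
    obtain n y where "y \<in> W n" "y \<noteq> p" "dist y p < 1" using near[of 1 0] by auto
    then show "\<exists>c. P 0 c" by (intro exI[of _ "(n, y)"]) (simp add: P_def)
  next
    fix c :: "nat \<times> 'a" and k
    assume "P k c"
    then have "min (1 / (real (Suc k) + 1)) (dist (snd c) p / 3) > 0" by (simp add: P_def)
    from near[OF this, of "fst c"] obtain n y where "n > fst c" "y \<in> W n" "y \<noteq> p"
      "dist y p < min (1 / (real (Suc k) + 1)) (dist (snd c) p / 3)" by blast
    then show "\<exists>d. P (Suc k) d \<and>
        (fst c < fst d \<and> dist (snd d) p < dist (snd c) p / 3)"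
      by (intro exI[of _ "(n, y)"]) (simp add: P_def)
  qed
  then obtain c where P: "\<And>k. P k (c k)" and up: "\<And>k. fst (c k) < fst (c (Suc k))"
    and down: "\<And>k. dist (snd (c (Suc k))) p < dist (snd (c k)) p / 3" by blast
  define x where "x k = snd (c k)" for k
  define d where "d k = dist (x k) p" for k
  have d_pos: "d k > 0" for k using P[of k] by (simp add: P_def d_def x_def)
  have "d (Suc k) \<le> d k" for k
    using down[of k] d_pos[of k] unfolding d_def x_def by linarith
  then have d_anti: "decseq d" by (simp add: decseq_Suc_iff)
  have d_less: "d k < d j / 3" if "j < k" for j k
  proof -
    have "d k \<le> d (Suc j)" using d_anti that by (simp add: decseq_def)
    then show ?thesis using down[of j] by (simp add: d_def x_def)
  qed
  have far: "d j / 2 + d k / 2 \<le> dist (x j) (x k)" if "j < k" for j k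
    using d_less[OF that] dist_triangle[of "x j" p "x k"] by (simp add: d_def)
  have "disjoint_family (\<lambda>k. ball (x k) (d k / 2))"
    unfolding disjoint_family_on_def
  proof (intro ballI impI)
    fix j k :: nat assume "j \<noteq> k"
    then have "d j / 2 + d k / 2 \<le> dist (x j) (x k)"
      using far[of j k] far[of k j] by (cases "j < k") (auto simp: dist_commute)
    then show "ball (x j) (d j / 2) \<inter> ball (x k) (d k / 2) = {}"
      by (rule disjoint_ballI)
  qed
  moreover have "strict_mono (\<lambda>k. fst (c k))" using up by (simp add: strict_mono_Suc_iff)
  moreover have "p \<notin> ball (x k) (d k / 2)" for k using d_pos[of k] by (simp add: d_def)
  moreover have "x k \<in> W (fst (c k)) \<and> d k / 2 > 0 \<and> dist (x k) p < 1 / (real k + 1)" for k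
    using P[of k] d_pos[of k] by (simp add: P_def x_def)
  ultimately show ?thesis
    by (intro exI[of _ "\<lambda>k. fst (c k)"] exI[of _ x] exI[of _ "\<lambda>k. d k / 2"]) simp
qed

text \<open>Without a cluster point each value is taken only finitely often, so there is an injective
  subsequence, and each of its points keeps a positive distance from all the others. The companion
  \<open>t k\<close> is taken within half of that distance, and the radius of the ball around \<open>s (\<sigma> k)\<close> is exactly
  the distance to \<open>t k\<close>. So \<open>t k\<close> just misses its own ball, and it is too far from the others.\<close>

lemma disjoint_balls_without_cluster_point:
  fixes s :: "nat \<Rightarrow> 'a::metric_space"
  assumes acc: "\<And>n. s n islimpt UNIV"
    and no_cluster: "\<And>p. \<exists>e>0. finite {n. dist (s n) p < e}"
  shows "\<exists>\<sigma> t r. strict_mono \<sigma> \<and> (\<forall>k::nat. r k > 0 \<and> dist (s (\<sigma> k)) (t k) < 1 / (real k + 1) \<and>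
      (\<forall>j. t k \<notin> ball (s (\<sigma> j)) (r j))) \<and> disjoint_family (\<lambda>k. ball (s (\<sigma> k)) (r k))"
proof -
  have fibre: "finite {n. s n = p}" for p
  proof -
    obtain e where "e > 0" "finite {n. dist (s n) p < e}" using no_cluster by blast
    then show ?thesis by (auto elim: rev_finite_subset)
  qed
  \<comment> \<open>The indices of first occurrences: \<open>s\<close> is injective on \<open>M\<close> and takes all its values there.\<close>
  define M where "M = {n. \<forall>m<n. s m \<noteq> s n}"
  have "range s \<subseteq> s ` M"
  proof
    fix y assume "y \<in> range s"
    then obtain n where "s n = y" by blast
    then have "(LEAST n. s n = y) \<in> M" and "s (LEAST n. s n = y) = y"
      using not_less_Least LeastI[of "\<lambda>n. s n = y"] by (auto simp: M_def)
    then show "y \<in> s ` M" by force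
  qed
  moreover have "infinite (range s)"
  proof
    assume "finite (range s)"
    then obtain n where "infinite {m. s m = s n}"
      using pigeonhole_infinite[of "UNIV :: nat set" s] by auto
    then show False using fibre by blast
  qed
  ultimately have M: "infinite M" by (meson finite_imageI finite_subset)
  define \<sigma> where "\<sigma> = enumerate M"
  have mono: "strict_mono \<sigma>" using M by (simp add: \<sigma>_def strict_mono_enumerate)
  have less_ne: "s (\<sigma> j) \<noteq> s (\<sigma> k)" if "j < k" for j k
    using enumerate_in_set[OF M, of k] strict_monoD[OF mono that] by (auto simp: M_def \<sigma>_def)
  have "\<exists>\<rho>>0. \<forall>j. j \<noteq> k \<longrightarrow> 2 * \<rho> \<le> dist (s (\<sigma> k)) (s (\<sigma> j))" for k
  proof -
    obtain e where e: "e > 0" "finite {n. dist (s n) (s (\<sigma> k)) < e}" using no_cluster by blast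
    have "finite (s ` {n. dist (s n) (s (\<sigma> k)) < e})" using e by blast
    then obtain d where d: "d > 0"
      "\<And>y. y \<in> s ` {n. dist (s n) (s (\<sigma> k)) < e} \<Longrightarrow> y \<noteq> s (\<sigma> k) \<Longrightarrow> d \<le> dist (s (\<sigma> k)) y"
      using finite_set_avoid[of "s ` {n. dist (s n) (s (\<sigma> k)) < e}" "s (\<sigma> k)"] by auto
    \<comment> \<open>Terms of \<open>s\<close> at distance less than \<open>e\<close> are kept away by \<open>d\<close>, the others by \<open>e\<close> itself.\<close>
    have "2 * (min d e / 2) \<le> dist (s (\<sigma> k)) (s (\<sigma> j))" if "j \<noteq> k" for j
    proof -
      have "s (\<sigma> j) \<noteq> s (\<sigma> k)" using less_ne[of j k] less_ne[of k j] that by (cases "j < k") auto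
      then show ?thesis
        using d(2)[of "s (\<sigma> j)"]
        by (cases "dist (s (\<sigma> j)) (s (\<sigma> k)) < e") (auto simp: dist_commute)
    qed
    then show ?thesis using d(1) e(1) by (intro exI[of _ "min d e / 2"]) auto
  qed
  then obtain \<rho> where \<rho>: "\<And>k. \<rho> k > 0"
    "\<And>k j. j \<noteq> k \<Longrightarrow> 2 * \<rho> k \<le> dist (s (\<sigma> k)) (s (\<sigma> j))" by metis
  have "\<exists>y. y \<noteq> s (\<sigma> k) \<and> dist y (s (\<sigma> k)) < min (\<rho> k) (1 / (real k + 1))" for k
    using islimpt_approachable[THEN iffD1, OF acc[of "\<sigma> k"], rule_format,
        of "min (\<rho> k) (1 / (real k + 1))"] \<rho>(1)[of k] by auto
  then obtain t where t: "\<And>k. t k \<noteq> s (\<sigma> k)"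
    "\<And>k. dist (t k) (s (\<sigma> k)) < min (\<rho> k) (1 / (real k + 1))" by metis
  define r where "r k = dist (t k) (s (\<sigma> k))" for k
  have far: "r j + r k \<le> dist (s (\<sigma> j)) (s (\<sigma> k))" if "j \<noteq> k" for j k
  proof -
    have "r j < \<rho> j" "r k < \<rho> k" using t(2) by (auto simp: r_def)
    then show ?thesis using \<rho>(2)[OF that] \<rho>(2)[OF that[symmetric]] by (simp add: dist_commute)
  qed
  have "disjoint_family (\<lambda>k. ball (s (\<sigma> k)) (r k))"
    unfolding disjoint_family_on_def by (intro ballI impI disjoint_ballI far)
  moreover have "t k \<notin> ball (s (\<sigma> j)) (r j)" for j k
  proof (cases "j = k")
    case False
    then show ?thesis
      using far[OF False] dist_triangle[of "s (\<sigma> j)" "s (\<sigma> k)" "t k"] by (simp add: r_def dist_commute)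
  qed (simp add: r_def dist_commute)
  moreover have "r k > 0 \<and> dist (s (\<sigma> k)) (t k) < 1 / (real k + 1)" for k
    using t[of k] by (simp add: r_def dist_commute)
  ultimately show ?thesis using mono by blast
qed

text \<open>The sets \<open>W n\<close> leave room to move the chosen point off \<open>s n\<close>. This freedom is essential when \<open>s n\<close>
  takes the same value for infinitely many \<open>n\<close>.\<close>

lemma disjoint_balls_near_accumulation_points:
  fixes s :: "nat \<Rightarrow> 'a::metric_space"
  assumes acc: "\<And>n. s n islimpt UNIV"
    and W: "\<And>n. open (W n)" "\<And>n. s n \<in> W n"
  obtains \<sigma> x r t where "strict_mono \<sigma>" and "\<And>k::nat. x k \<in> W (\<sigma> k)" and "\<And>k. r k > 0"
    and "\<And>k. dist (x k) (t k) < 1 / (real k + 1)"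
    and "\<And>j k. t k \<notin> ball (x j) (r j)"
    and "disjoint_family (\<lambda>k. ball (x k) (r k))"
proof (cases "\<exists>p. \<forall>e>0. infinite {n. dist (s n) p < e}")
  case True
  then obtain p where "\<And>e. e > 0 \<Longrightarrow> infinite {n. dist (s n) p < e}" by blast
  from disjoint_balls_near_cluster_point[OF acc W this] obtain \<sigma> x r where
    "strict_mono \<sigma>" "disjoint_family (\<lambda>k. ball (x k) (r k))"
    "\<And>k::nat. x k \<in> W (\<sigma> k) \<and> r k > 0 \<and> dist (x k) p < 1 / (real k + 1) \<and> p \<notin> ball (x k) (r k)"
    by blast
  then show thesis using that[of \<sigma> x r "\<lambda>_. p"] by blast
next
  case False
  then have "\<exists>e>0. finite {n. dist (s n) p < e}" for p by blast
  from disjoint_balls_without_cluster_point[OF acc this] obtain \<sigma> t r where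
    "strict_mono \<sigma>" "disjoint_family (\<lambda>k. ball (s (\<sigma> k)) (r k))"
    "\<And>k::nat. r k > 0 \<and> dist (s (\<sigma> k)) (t k) < 1 / (real k + 1) \<and>
      (\<forall>j. t k \<notin> ball (s (\<sigma> j)) (r j))"
    by blast
  then show thesis using that[of \<sigma> "\<lambda>k. s (\<sigma> k)" r t] W by blast
qed

section \<open>Continuity of the map for the supremum over accumulation points\<close>

lemma add_Ub_space:
  assumes "(A :: ('a::metric_space \<Rightarrow> 'b::real_normed_vector) set) = U_space \<or> A = Ub_space"
    and "f \<in> A" and "h \<in> Ub_space"
  shows "(\<lambda>x. f x + h x) \<in> A"
  using assms by (auto simp: U_space_def Ub_space_def uniformly_continuous_on_add
      intro: bounded_plus_comp)

theorem theorem7p10: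
  fixes A :: "('x::complete_space \<Rightarrow> 'e::banach) set"
    and B :: "('y::complete_space \<Rightarrow> 'f::banach) set"
    and T :: "('x \<Rightarrow> 'e) \<Rightarrow> ('y \<Rightarrow> 'f)"
    and \<phi> :: "'x \<Rightarrow> 'y"
    and \<Phi> :: "'y \<Rightarrow> 'e \<Rightarrow> 'f"
    and f :: "'x \<Rightarrow> 'e"
    and S :: "'x set"
    and \<epsilon> :: real
  assumes E_nontrivial: "\<exists>e::'e. e \<noteq> 0"
    and F_nontrivial: "\<exists>v::'f. v \<noteq> 0"
    and spaces: "(A = U_space \<and> B = U_space) \<or> (A = Ub_space \<and> B = Ub_space)"
    and T: "biseparating A B T"
    and \<phi>: "uniform_homeomorphism \<phi>"
    and \<Phi>: "\<And>y. bij (\<Phi> y)"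
    and repr: "\<And>u y. u \<in> A \<Longrightarrow> T u y = \<Phi> y (u (inv \<phi> y))"
    and f: "f \<in> A"
    and S: "S \<subseteq> accumulation_points"
    and \<epsilon>: "\<epsilon> > 0"
  shows "\<exists>\<delta>::real. \<delta> > 0 \<and>
    (\<forall>g\<in>A. sup_norm_on S (\<lambda>x. g x - f x) < ennreal \<delta> \<longrightarrow>
       sup_norm_on (\<phi> ` S) (\<lambda>y. T g y - T f y) < ennreal \<epsilon>)"
proof (rule ccontr)
  assume neg: "\<not> ?thesis"
  have A_uc: "uniformly_continuous_on UNIV u" if "u \<in> A" for u
    using that spaces by (auto simp: U_space_def Ub_space_def)
  have T_uc: "uniformly_continuous_on UNIV (\<lambda>x. T u (\<phi> x))" if "u \<in> A" for u
  proof -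
    have "bij_betw T A B" using T unfolding biseparating_def by (rule conjunct1)
    then have "T u \<in> B" using that by (rule bij_betw_apply)
    then have "uniformly_continuous_on UNIV (T u)"
      using spaces by (auto simp: U_space_def Ub_space_def)
    moreover have "uniformly_continuous_on UNIV \<phi>" and "range \<phi> = UNIV"
      using \<phi> by (simp_all add: uniform_homeomorphism_def bij_is_surj)
    ultimately show ?thesis using uniformly_continuous_on_compose[of UNIV \<phi> "T u"] by simp
  qed
  have T_local: "T u (\<phi> x) = T v (\<phi> x)" if "u \<in> A" "v \<in> A" "u x = v x" for u v x
  proof -
    have "inv \<phi> (\<phi> x) = x"
      using \<phi> by (simp add: uniform_homeomorphism_def bij_is_inj)
    then show ?thesis using that repr[OF that(1)] repr[OF that(2)] by simp
  qed
  have "\<exists>g s. g \<in> A \<and> s \<in> S \<and> norm (g s - f s) < 1 / (real n + 1) \<and>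
      norm (T g (\<phi> s) - T f (\<phi> s)) > \<epsilon> / 2" for n
  proof -
    have "1 / (real n + 1) > 0" by simp
    with neg obtain g where g: "g \<in> A"
      "sup_norm_on S (\<lambda>x. g x - f x) < ennreal (1 / (real n + 1))"
      "\<not> sup_norm_on (\<phi> ` S) (\<lambda>y. T g y - T f y) < ennreal \<epsilon>" by blast
    have "ennreal (\<epsilon> / 2) < ennreal \<epsilon>" using \<epsilon> by (simp add: ennreal_lessI)
    also have "\<dots> \<le> sup_norm_on (\<phi> ` S) (\<lambda>y. T g y - T f y)" using g(3) by simp
    finally obtain s where s: "s \<in> S" "ennreal (\<epsilon> / 2) < ennreal (norm (T g (\<phi> s) - T f (\<phi> s)))"
      by (auto simp: sup_norm_on_def less_SUP_iff)
    have "ennreal (norm (g s - f s)) \<le> sup_norm_on S (\<lambda>x. g x - f x)"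
      unfolding sup_norm_on_def using s(1) by (rule SUP_upper)
    also note g(2)
    finally have "norm (g s - f s) < 1 / (real n + 1)" by (simp add: ennreal_less_iff)
    moreover have "\<epsilon> / 2 < norm (T g (\<phi> s) - T f (\<phi> s))" using s(2) \<epsilon> by (simp add: ennreal_less_iff)
    ultimately show ?thesis using g(1) s(1) by blast
  qed
  then obtain G s where G: "\<And>n. G n \<in> A" and s: "\<And>n. s n \<in> S"
    and small: "\<And>n. norm (G n (s n) - f (s n)) < 1 / (real n + 1)"
    and large: "\<And>n. norm (T (G n) (\<phi> (s n)) - T f (\<phi> (s n))) > \<epsilon> / 2" by metis
  \<comment> \<open>Both inequalities at \<open>s n\<close> are open conditions, so any point of \<open>W n\<close> can replace \<open>s n\<close>.\<close>
  define W where "W n = {x. norm (G n x - f x) < 1 / (real n + 1)} \<inter>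
      {x. \<epsilon> / 2 < norm (T (G n) (\<phi> x) - T f (\<phi> x))}" for n
  have W_open: "open (W n)" for n
  proof -
    have "continuous_on UNIV (\<lambda>x. norm (G n x - f x))"
      by (intro continuous_on_norm continuous_on_diff
          uniformly_continuous_imp_continuous A_uc[OF G] A_uc[OF f])
    moreover have "continuous_on UNIV (\<lambda>x. norm (T (G n) (\<phi> x) - T f (\<phi> x)))"
      by (intro continuous_on_norm continuous_on_diff
          uniformly_continuous_imp_continuous T_uc[OF G] T_uc[OF f])
    ultimately show ?thesis
      unfolding W_def by (intro open_Int open_Collect_less continuous_on_const)
  qed
  have s_acc: "s n islimpt UNIV" and s_W: "s n \<in> W n" for n
    using small large s S by (auto simp: W_def accumulation_points_def)
  obtain \<sigma> x r t where \<sigma>: "strict_mono \<sigma>" and x: "\<And>k::nat. x k \<in> W (\<sigma> k)"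
    and r: "\<And>k. r k > 0" and t: "\<And>k. dist (x k) (t k) < 1 / (real k + 1)"
    and off: "\<And>j k. t k \<notin> ball (x j) (r j)"
    and disj: "disjoint_family (\<lambda>k. ball (x k) (r k))"
    by (rule disjoint_balls_near_accumulation_points[of s W, OF s_acc W_open s_W]) (rule that)
  define b where "b k = G (\<sigma> k) (x k) - f (x k)" for k
  have inv_lim: "(\<lambda>k. 1 / (real k + 1)) \<longlonglongrightarrow> 0"
    using LIMSEQ_inverse_real_of_nat by (simp add: inverse_eq_divide add.commute)
  have "norm (b k) \<le> 1 / (real k + 1)" for k
  proof -
    have "norm (b k) < 1 / (real (\<sigma> k) + 1)" using x[of k] by (simp add: W_def b_def)
    also have "\<dots> \<le> 1 / (real k + 1)" using seq_suble[OF \<sigma>, of k] by (simp add: frac_le)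
    finally show ?thesis by simp
  qed
  then have b_lim: "b \<longlonglongrightarrow> 0" by (intro Lim_null_comparison[OF _ inv_lim]) simp
  obtain h where h: "h \<in> Ub_space" "\<And>k. h (x k) = b k"
    "\<And>z. \<forall>k. z \<notin> ball (x k) (r k) \<Longrightarrow> h z = 0"
    by (rule vanishing_bumps_on_disjoint_balls[OF r disj b_lim]) (rule that)
  define g where "g z = f z + h z" for z
  have g: "g \<in> A" unfolding g_def using spaces by (intro add_Ub_space[OF _ f h(1)]) auto
  have at_x: "T g (\<phi> (x k)) = T (G (\<sigma> k)) (\<phi> (x k))" for k
    by (rule T_local[OF g G]) (simp add: g_def h(2) b_def)
  have at_t: "T g (\<phi> (t k)) = T f (\<phi> (t k))" for k
    using h(3)[of "t k"] off by (intro T_local[OF g f]) (simp add: g_def)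
  define D where "D z = T g (\<phi> z) - T f (\<phi> z)" for z
  have "uniformly_continuous_on UNIV D"
    unfolding D_def by (intro uniformly_continuous_on_diff T_uc g f)
  from this half_gt_zero[OF \<epsilon>] obtain \<eta> where "\<eta> > 0"
    and \<eta>: "\<And>u v. dist u v < \<eta> \<Longrightarrow> dist (D u) (D v) < \<epsilon> / 2"
    by (rule uniformly_continuous_onE) simp
  obtain k where "1 / (real k + 1) < \<eta>"
    using nat_approx_posE[OF \<open>\<eta> > 0\<close>] by (metis of_nat_Suc add.commute)
  with t[of k] have "dist (x k) (t k) < \<eta>" by linarith
  from \<eta>[OF this] have "norm (D (x k)) < \<epsilon> / 2" using at_t by (simp add: D_def dist_norm)
  moreover have "norm (D (x k)) > \<epsilon> / 2" using x[of k] by (simp add: D_def at_x W_def)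
  ultimately show False by simp
qed

end
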